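(* Assume that the stage controls satisfy $$\tilde\omega_k f_u(Y_n^{(k)},u_n^k)^T\tilde P_n^{(k)}+\omega_k g_u(Y_n^{(k)},u_n^k)^TP_n^{(k)}=0,\qquad k=1,\dots,s,$$ and that $\tilde\omega_i=\omega_i$ for all $i=1,\dots,s$. Then the discretization scheme consisting of (S) together with (A) is a symplectic scheme for the reduced Hamiltonian system $$\dot y=f(y,\varphi(y,p))+g(y,\varphi(y,p)),\qquad \dot p=-f_y(y,\varphi(y,p))^Tp-g_y(y,\varphi(y,p))^Tp,$$ that is, the one-step map $(y_n,p_n)\mapsto(y_{n+1},p_{n+1})$ satisfies $$\sum_{r=1}^K dy_{n+1}^r\wedge dp_{n+1}^r=\sum_{r=1}^K dy_n^r\wedge dp_n^r .$$
   Context: Let $f,g:\mathbb{R}^K\times\mathbb{R}^m\to\mathbb{R}^K$ be sufficiently smooth, with Jacobians $f_y,g_y$ in $y$ and $f_u,g_u$ in $u$. Real coefficients $\tilde a_{ij},a_{ij}$ and weights $\tilde\omega_i\neq0$, $\omega_i\ne0$ ($i,j=1,\dots,s$) are given, and $h>0$ is the step size. (S): $Y_n^{(i)}=y_n+h\sum_{j}\tilde a_{ij}f(Y_n^{(j)},u_n^j)+h\sum_{j}a_{ij}g(Y_n^{(j)},u_n^j)$ ($i=1,\dots,s$), $\;y_{n+1}=y_n+h\sum_i\tilde\omega_if(Y_n^{(i)},u_n^i)+h\sum_i\omega_ig(Y_n^{(i)},u_n^i)$. (A): for $i=1,\dots,s$, $$\tilde P_n^{(i)}=p_n-h\sum_{j}\tilde\alpha_{ij}f_y(Y_n^{(j)},u_n^j)^T\tilde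 P_n^{(j)}-h\sum_{j}\alpha_{ij}g_y(Y_n^{(j)},u_n^j)^TP_n^{(j)},$$ $$P_n^{(i)}=p_n-h\sum_{j}\tilde\beta_{ij}f_y(Y_n^{(j)},u_n^j)^T\tilde P_n^{(j)}-h\sum_{j}\beta_{ij}g_y(Y_n^{(j)},u_n^j)^TP_n^{(j)},$$ $$p_{n+1}=p_n-h\sum_{i}\tilde\omega_if_y(Y_n^{(i)},u_n^i)^T\tilde P_n^{(i)}-h\sum_{i}\omega_ig_y(Y_n^{(i)},u_n^i)^TP_n^{(i)},$$ with $\tilde\alpha_{ij}=\tilde\omega_j-\frac{\tilde\omega_j}{\tilde\omega_i}\tilde a_{ji}$, $\alpha_{ij}=\omega_j-\frac{\omega_j}{\tilde\omega_i}\tilde a_{ji}$, $\tilde\beta_{ij}=\tilde\omega_j-\frac{\tilde\omega_j}{\omega_i}a_{ji}$, $\beta_{ij}=\omega_j-\frac{\omega_j}{\omega_i}a_{ji}$. The Hamiltonian is $H(y,u,p)=p^T(f(y,u)+g(y,u))$. It is assumed that $H_{uu}$ is locally invertible, so that $H_u(y,u,p)=0$ is locally solved by a smooth function $u=\varphi(y,p)$; the reduced Hamiltonian is $\mathcal H(y,p)=H(y,\varphi(y,p),p)$, and the displayed reduced system is $\dot y=\mathcal H_p$, $\dot p=-\mathcal H_y$. It is also assumed that the stage condition in the claim is locally equivalent to $u_n^i=\tilde\varphi(Y_n^{(i)},P_n^{(i)},\tilde P_n^{(i)})$ for a smooth function $\tilde\varphi$ with $\tilde\varphi(y,p,\tilde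 p)=\varphi(y,p)$ whenever $\tilde p=p$. All statements are local, with $h$ such that the scheme defines $Y_n^{(i)},\tilde P_n^{(i)},P_n^{(i)},u_n^i,y_{n+1},p_{n+1}$ as continuously differentiable functions of $(y_n,p_n)\in\mathbb{R}^K\times\mathbb{R}^K$; the differentials $dy_{n+1}^r,dp_{n+1}^r$ are those of the $r$-th components as functions of $(y_n,p_n)$. *)

theory Defs
  imports "HOL-Analysis.Analysis"
begin

subsection \<open>Smoothness, gradients, local solution functions\<close>

text \<open>\<open>Ck n f S\<close>: \<open>f\<close> is \<open>n\<close> times continuously differentiable on the open set \<open>S\<close>.  On
  finite-dimensional spaces, continuity of all iterated directional derivatives is the same as
  continuity of the derivatives as multilinear maps.\<close>

primrec Ck :: "nat \<Rightarrow> ('a::real_normed_vector \<Rightarrow> 'b::real_normed_vector) \<Rightarrow> 'a set \<Rightarrow> bool" where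
  "Ck 0 f S \<longleftrightarrow> continuous_on S f"
| "Ck (Suc n) f S \<longleftrightarrow>
     (\<forall>x\<in>S. f differentiable (at x)) \<and> (\<forall>v. Ck n (\<lambda>x. frechet_derivative f (at x) v) S)"

definition grad :: "(real^'n \<Rightarrow> real) \<Rightarrow> real^'n \<Rightarrow> real^'n" where
  "grad F x = (\<chi> i. frechet_derivative F (at x) (axis i 1))"

text \<open>The equation \<open>E x u\<close> is solved locally, that is in the open set \<open>W\<close>, by the
  \<open>C\<^sup>1\<close> function \<open>u = \<phi> x\<close> defined on the open set \<open>X\<close>.\<close>

definition locally_solved_by ::
  "('a::real_normed_vector \<Rightarrow> 'b::real_normed_vector \<Rightarrow> bool) \<Rightarrow> ('a \<times> 'b) set \<Rightarrow> 'a set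
    \<Rightarrow> ('a \<Rightarrow> 'b) \<Rightarrow> bool" where
  "locally_solved_by E W X \<phi> \<longleftrightarrow>
     open W \<and> open X \<and> Ck 1 \<phi> X \<and>
     (\<forall>x\<in>X. (x, \<phi> x) \<in> W) \<and>
     (\<forall>(x, u)\<in>W. x \<in> X \<and> (E x u \<longleftrightarrow> u = \<phi> x))"

subsection \<open>Jacobians and Hamiltonian\<close>

definition jac_y :: "((real^'k) \<times> (real^'m) \<Rightarrow> real^'k) \<Rightarrow> real^'k \<Rightarrow> real^'m \<Rightarrow> real^'k^'k" where
  "jac_y f y u = jacobian (\<lambda>x. f (x, u)) (at y)"

definition jac_u :: "((real^'k) \<times> (real^'m) \<Rightarrow> real^'k) \<Rightarrow> real^'k \<Rightarrow> real^'m \<Rightarrow> real^'m^'k" where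
  "jac_u f y u = jacobian (\<lambda>v. f (y, v)) (at u)"

definition hamiltonian ::
  "((real^'k) \<times> (real^'m) \<Rightarrow> real^'k) \<Rightarrow> ((real^'k) \<times> (real^'m) \<Rightarrow> real^'k) \<Rightarrow>
   real^'k \<Rightarrow> real^'m \<Rightarrow> real^'k \<Rightarrow> real" where
  "hamiltonian f g y u p = p \<bullet> (f (y, u) + g (y, u))"

definition hamiltonian_u ::
  "((real^'k) \<times> (real^'m) \<Rightarrow> real^'k) \<Rightarrow> ((real^'k) \<times> (real^'m) \<Rightarrow> real^'k) \<Rightarrow>
   real^'k \<Rightarrow> real^'m \<Rightarrow> real^'k \<Rightarrow> real^'m" where
  "hamiltonian_u f g y u p = grad (\<lambda>v. hamiltonian f g y v p) u"

definition hamiltonian_uu ::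
  "((real^'k) \<times> (real^'m) \<Rightarrow> real^'k) \<Rightarrow> ((real^'k) \<times> (real^'m) \<Rightarrow> real^'k) \<Rightarrow>
   real^'k \<Rightarrow> real^'m \<Rightarrow> real^'k \<Rightarrow> real^'m^'m" where
  "hamiltonian_uu f g y u p = jacobian (\<lambda>v. hamiltonian_u f g y v p) (at u)"

definition reduced_hamiltonian ::
  "((real^'k) \<times> (real^'m) \<Rightarrow> real^'k) \<Rightarrow> ((real^'k) \<times> (real^'m) \<Rightarrow> real^'k) \<Rightarrow>
   ((real^'k) \<times> (real^'k) \<Rightarrow> real^'m) \<Rightarrow> (real^'k) \<times> (real^'k) \<Rightarrow> real" where
  "reduced_hamiltonian f g \<phi> = (\<lambda>(y, p). hamiltonian f g y (\<phi> (y, p)) p)"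

definition reduced_field ::
  "((real^'k) \<times> (real^'m) \<Rightarrow> real^'k) \<Rightarrow> ((real^'k) \<times> (real^'m) \<Rightarrow> real^'k) \<Rightarrow>
   ((real^'k) \<times> (real^'k) \<Rightarrow> real^'m) \<Rightarrow> (real^'k) \<times> (real^'k) \<Rightarrow> (real^'k) \<times> (real^'k)" where
  "reduced_field f g \<phi> = (\<lambda>(y, p).
     (f (y, \<phi> (y, p)) + g (y, \<phi> (y, p)),
      - (transpose (jac_y f y (\<phi> (y, p))) *v p) - transpose (jac_y g y (\<phi> (y, p))) *v p))"

text \<open>The system with right-hand side \<open>V\<close> is the Hamiltonian system of \<open>\<H>\<close> on \<open>X\<close>.\<close>

definition is_hamiltonian_system ::
  "((real^'k) \<times> (real^'k)) set \<Rightarrow> ((real^'k) \<times> (real^'k) \<Rightarrow> real) \<Rightarrow>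
   ((real^'k) \<times> (real^'k) \<Rightarrow> (real^'k) \<times> (real^'k)) \<Rightarrow> bool" where
  "is_hamiltonian_system X \<H> V \<longleftrightarrow>
     (\<forall>(y, p)\<in>X. \<H> differentiable (at (y, p)) \<and>
        V (y, p) = (grad (\<lambda>q. \<H> (y, q)) p, - grad (\<lambda>x. \<H> (x, p)) y))"

subsection \<open>The scheme\<close>

text \<open>Throughout, a prime stands for the tilde: \<open>a'\<close>, \<open>\<omega>'\<close>, \<open>P'\<close>, \<open>\<phi>'\<close>.\<close>

definition state_step ::
  "((real^'k) \<times> (real^'m) \<Rightarrow> real^'k) \<Rightarrow> ((real^'k) \<times> (real^'m) \<Rightarrow> real^'k) \<Rightarrow> real \<Rightarrow>
   ('s::finite \<Rightarrow> 's \<Rightarrow> real) \<Rightarrow> ('s \<Rightarrow> 's \<Rightarrow> real) \<Rightarrow> ('s \<Rightarrow> real) \<Rightarrow> ('s \<Rightarrow> real) \<Rightarrow>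
   real^'k \<Rightarrow> ('s \<Rightarrow> real^'k) \<Rightarrow> ('s \<Rightarrow> real^'m) \<Rightarrow> real^'k \<Rightarrow> bool" where
  "state_step f g h a' a \<omega>' \<omega> y Y u ynext \<longleftrightarrow>
     (\<forall>i. Y i = y + h *\<^sub>R (\<Sum>j\<in>UNIV. a' i j *\<^sub>R f (Y j, u j))
                  + h *\<^sub>R (\<Sum>j\<in>UNIV. a i j *\<^sub>R g (Y j, u j))) \<and>
     ynext = y + h *\<^sub>R (\<Sum>i\<in>UNIV. \<omega>' i *\<^sub>R f (Y i, u i))
               + h *\<^sub>R (\<Sum>i\<in>UNIV. \<omega> i *\<^sub>R g (Y i, u i))"

text \<open>All four adjoint coefficient families have the form
  \<open>w\<^sub>j - (w\<^sub>j / v\<^sub>i) b\<^sub>j\<^sub>i\<close>; note the transposition of \<open>b\<close>.\<close>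

definition adj_coeff ::
  "('s \<Rightarrow> real) \<Rightarrow> ('s \<Rightarrow> real) \<Rightarrow> ('s \<Rightarrow> 's \<Rightarrow> real) \<Rightarrow> 's \<Rightarrow> 's \<Rightarrow> real" where
  "adj_coeff w v b i j = w j - w j / v i * b j i"

definition adjoint_step ::
  "((real^'k) \<times> (real^'m) \<Rightarrow> real^'k) \<Rightarrow> ((real^'k) \<times> (real^'m) \<Rightarrow> real^'k) \<Rightarrow> real \<Rightarrow>
   ('s::finite \<Rightarrow> 's \<Rightarrow> real) \<Rightarrow> ('s \<Rightarrow> 's \<Rightarrow> real) \<Rightarrow>
   ('s \<Rightarrow> 's \<Rightarrow> real) \<Rightarrow> ('s \<Rightarrow> 's \<Rightarrow> real) \<Rightarrow> ('s \<Rightarrow> real) \<Rightarrow> ('s \<Rightarrow> real) \<Rightarrow>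
   ('s \<Rightarrow> real^'k) \<Rightarrow> ('s \<Rightarrow> real^'m) \<Rightarrow>
   real^'k \<Rightarrow> ('s \<Rightarrow> real^'k) \<Rightarrow> ('s \<Rightarrow> real^'k) \<Rightarrow> real^'k \<Rightarrow> bool" where
  "adjoint_step f g h \<alpha>' \<alpha> \<beta>' \<beta> \<omega>' \<omega> Y u p P' P pnext \<longleftrightarrow>
     (\<forall>i. P' i = p - h *\<^sub>R (\<Sum>j\<in>UNIV. \<alpha>' i j *\<^sub>R (transpose (jac_y f (Y j) (u j)) *v P' j))
                   - h *\<^sub>R (\<Sum>j\<in>UNIV. \<alpha> i j *\<^sub>R (transpose (jac_y g (Y j) (u j)) *v P j))) \<and>
     (\<forall>i. P i = p - h *\<^sub>R (\<Sum>j\<in>UNIV. \<beta>' i j *\<^sub>R (transpose (jac_y f (Y j) (u j)) *v P' j))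
                  - h *\<^sub>R (\<Sum>j\<in>UNIV. \<beta> i j *\<^sub>R (transpose (jac_y g (Y j) (u j)) *v P j))) \<and>
     pnext = p - h *\<^sub>R (\<Sum>i\<in>UNIV. \<omega>' i *\<^sub>R (transpose (jac_y f (Y i) (u i)) *v P' i))
               - h *\<^sub>R (\<Sum>i\<in>UNIV. \<omega> i *\<^sub>R (transpose (jac_y g (Y i) (u i)) *v P i))"

definition control_condition ::
  "((real^'k) \<times> (real^'m) \<Rightarrow> real^'k) \<Rightarrow> ((real^'k) \<times> (real^'m) \<Rightarrow> real^'k) \<Rightarrow> real \<Rightarrow> real \<Rightarrow>
   real^'k \<Rightarrow> real^'m \<Rightarrow> real^'k \<Rightarrow> real^'k \<Rightarrow> bool" where
  "control_condition f g w' w y u p p' \<longleftrightarrow>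
     w' *\<^sub>R (transpose (jac_u f y u) *v p') + w *\<^sub>R (transpose (jac_u g y u) *v p) = 0"

subsection \<open>Being a scheme for the reduced system\<close>

text \<open>One step of an additive partitioned Runge--Kutta method for a system in \<open>(y, p)\<close> whose
  right-hand side is split as \<open>\<Phi> + \<Gamma>\<close>.  Both parts may depend on \<open>(y, p, p')\<close>, where \<open>p'\<close> is a
  second copy of \<open>p\<close> with its own stage values; the system being discretized is
  \<open>(y, p) \<mapsto> \<Phi> (y, p, p) + \<Gamma> (y, p, p)\<close>.\<close>

definition additive_prk_step ::
  "((real^'k) \<times> (real^'k) \<times> (real^'k) \<Rightarrow> (real^'k) \<times> (real^'k)) \<Rightarrow>
   ((real^'k) \<times> (real^'k) \<times> (real^'k) \<Rightarrow> (real^'k) \<times> (real^'k)) \<Rightarrow> real \<Rightarrow>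
   ('s::finite \<Rightarrow> 's \<Rightarrow> real) \<Rightarrow> ('s \<Rightarrow> 's \<Rightarrow> real) \<Rightarrow>
   ('s \<Rightarrow> 's \<Rightarrow> real) \<Rightarrow> ('s \<Rightarrow> 's \<Rightarrow> real) \<Rightarrow>
   ('s \<Rightarrow> 's \<Rightarrow> real) \<Rightarrow> ('s \<Rightarrow> 's \<Rightarrow> real) \<Rightarrow> ('s \<Rightarrow> real) \<Rightarrow> ('s \<Rightarrow> real) \<Rightarrow>
   (real^'k) \<times> (real^'k) \<Rightarrow> ('s \<Rightarrow> real^'k) \<Rightarrow> ('s \<Rightarrow> real^'k) \<Rightarrow> ('s \<Rightarrow> real^'k) \<Rightarrow>
   (real^'k) \<times> (real^'k) \<Rightarrow> bool" where
  "additive_prk_step \<Phi> \<Gamma> h a' a \<alpha>' \<alpha> \<beta>' \<beta> \<omega>' \<omega> z Y P P' znext \<longleftrightarrow>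
     (\<forall>i. Y i = fst z + h *\<^sub>R (\<Sum>j\<in>UNIV. a' i j *\<^sub>R fst (\<Phi> (Y j, P j, P' j)))
                      + h *\<^sub>R (\<Sum>j\<in>UNIV. a i j *\<^sub>R fst (\<Gamma> (Y j, P j, P' j)))) \<and>
     (\<forall>i. P' i = snd z + h *\<^sub>R (\<Sum>j\<in>UNIV. \<alpha>' i j *\<^sub>R snd (\<Phi> (Y j, P j, P' j)))
                       + h *\<^sub>R (\<Sum>j\<in>UNIV. \<alpha> i j *\<^sub>R snd (\<Gamma> (Y j, P j, P' j)))) \<and>
     (\<forall>i. P i = snd z + h *\<^sub>R (\<Sum>j\<in>UNIV. \<beta>' i j *\<^sub>R snd (\<Phi> (Y j, P j, P' j)))
                      + h *\<^sub>R (\<Sum>j\<in>UNIV. \<beta> i j *\<^sub>R snd (\<Gamma> (Y j, P j, P' j)))) \<and>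
     znext = z + h *\<^sub>R (\<Sum>i\<in>UNIV. \<omega>' i *\<^sub>R \<Phi> (Y i, P i, P' i))
               + h *\<^sub>R (\<Sum>i\<in>UNIV. \<omega> i *\<^sub>R \<Gamma> (Y i, P i, P' i))"

definition f_part ::
  "((real^'k) \<times> (real^'m) \<Rightarrow> real^'k) \<Rightarrow> ((real^'k) \<times> (real^'k) \<times> (real^'k) \<Rightarrow> real^'m) \<Rightarrow>
   (real^'k) \<times> (real^'k) \<times> (real^'k) \<Rightarrow> (real^'k) \<times> (real^'k)" where
  "f_part f \<phi>' = (\<lambda>(y, p, p').
     (f (y, \<phi>' (y, p, p')), - (transpose (jac_y f y (\<phi>' (y, p, p'))) *v p')))"

definition g_part ::
  "((real^'k) \<times> (real^'m) \<Rightarrow> real^'k) \<Rightarrow> ((real^'k) \<times> (real^'k) \<times> (real^'k) \<Rightarrow> real^'m) \<Rightarrow>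
   (real^'k) \<times> (real^'k) \<times> (real^'k) \<Rightarrow> (real^'k) \<times> (real^'k)" where
  "g_part g \<phi>' = (\<lambda>(y, p, p').
     (g (y, \<phi>' (y, p, p')), - (transpose (jac_y g y (\<phi>' (y, p, p'))) *v p)))"

subsection \<open>Symplecticity\<close>

definition wedge :: "('a \<Rightarrow> real) \<Rightarrow> ('a \<Rightarrow> real) \<Rightarrow> 'a \<Rightarrow> 'a \<Rightarrow> real" where
  "wedge \<alpha> \<beta> v w = \<alpha> v * \<beta> w - \<alpha> w * \<beta> v"

text \<open>The 2-form \<open>\<Sum>\<^sub>r dY\<^sup>r \<and> dP\<^sup>r\<close> at the point \<open>z\<close>, for functions \<open>Y\<close>, \<open>P\<close> of \<open>z\<close>.\<close>

definition sum_wedge ::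
  "('a::real_normed_vector \<Rightarrow> real^'k) \<Rightarrow> ('a \<Rightarrow> real^'k) \<Rightarrow> 'a \<Rightarrow> 'a \<Rightarrow> 'a \<Rightarrow> real" where
  "sum_wedge Y P z = (\<lambda>v w. \<Sum>r\<in>UNIV.
     wedge (frechet_derivative (\<lambda>x. Y x $ r) (at z)) (frechet_derivative (\<lambda>x. P x $ r) (at z)) v w)"

end

theory Submission
  imports Defs
begin

text \<open>Differentiating the scheme gives linear relations between the differentials of \<open>Y\<close>, \<open>P\<close>,
  \<open>P'\<close> and of \<open>F = f (Y, u)\<close>, \<open>G = g (Y, u)\<close>, \<open>L = f\<^sub>y\<^sup>T P'\<close>, \<open>M = g\<^sub>y\<^sup>T P\<close>.  In the difference
  of the two-forms, the adjoint coefficients make all terms of order \<open>h\<^sup>2\<close> cancel.  What remains is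
  \<open>h\<close> times the sum over the stages of
  \<open>\<omega>' (dF \<and> dP' - dY \<and> dL) + \<omega> (dG \<and> dP - dY \<and> dM)\<close>.  The control condition says that the
  functional \<open>\<omega>' P' \<bullet> f' + \<omega> P \<bullet> g'\<close> on \<open>(y, u)\<close>-space annihilates the \<open>u\<close>-directions; differentiating
  this and using symmetry of \<open>f''\<close> and \<open>g''\<close> shows that each stage contributes zero.\<close>

subsection \<open>Symmetry of second derivatives\<close>

text \<open>By the mean value theorem in the direction \<open>d\<close>, the second difference is \<open>t\<close> times an
  increment of \<open>\<lambda>x. f' x d\<close> over the vector \<open>t *\<^sub>R e\<close>.\<close>

lemma second_difference_tendsto:
  fixes f :: "'a::real_normed_vector \<Rightarrow> real"
  assumes f: "\<And>x. (f has_derivative f' x) (at x)"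
    and A: "((\<lambda>x. f' x d) has_derivative A) (at x)"
  shows "((\<lambda>t. (f (x + t *\<^sub>R d + t *\<^sub>R e) - f (x + t *\<^sub>R d) - f (x + t *\<^sub>R e) + f x) / t\<^sup>2)
           \<longlongrightarrow> A e) (at_right 0)"
proof (rule tendstoI)
  fix r :: real assume r: "r > 0"
  \<comment> \<open>\<open>t * c\<close> bounds both displacements from \<open>x\<close> used below;
    the summand 1 keeps \<open>c\<close> positive even if \<open>d = e = 0\<close>. Two
    linearization errors of at most \<open>\<epsilon> * (t * c)\<close> each then add up to
    \<open>t * (r / 2)\<close>.\<close>
  define c where "c = norm d + norm e + 1"
  have c: "c > 0" unfolding c_def by (smt (verit) norm_ge_zero)
  define \<epsilon> where "\<epsilon> = r / (4 * c)"
  have \<epsilon>: "\<epsilon> > 0" using r c by (simp add: \<epsilon>_def)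
  interpret A: bounded_linear A using A by (rule has_derivative_bounded_linear)
  obtain \<delta> where \<delta>: "\<delta> > 0" and bd: "\<And>y. norm (y - x) < \<delta> \<Longrightarrow>
      norm (f' y d - f' x d - A (y - x)) \<le> \<epsilon> * norm (y - x)"
    using A \<epsilon> unfolding has_derivative_at_alt by blast
  have main: "dist ((f (x + t *\<^sub>R d + t *\<^sub>R e) - f (x + t *\<^sub>R d) - f (x + t *\<^sub>R e) + f x) / t\<^sup>2) (A e) < r"
    if t: "0 < t" "t < \<delta> / c" for t
  proof -
    \<comment> \<open>The second difference is \<open>\<psi> t - \<psi> 0\<close>, where
      \<open>\<psi> s\<close> is the increment over \<open>t *\<^sub>R e\<close> started at distance
      parameter \<open>s\<close> along \<open>d\<close>. This makes the one-variable mean value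
      theorem applicable.\<close>
    define \<psi> where "\<psi> s = f (x + s *\<^sub>R d + t *\<^sub>R e) - f (x + s *\<^sub>R d)" for s
    have D\<psi>: "(\<psi> has_derivative (\<lambda>\<sigma>. f' (x + s *\<^sub>R d + t *\<^sub>R e) (\<sigma> *\<^sub>R d) - f' (x + s *\<^sub>R d) (\<sigma> *\<^sub>R d))) (at s)" for s
    proof -
      have "((\<lambda>s. x + s *\<^sub>R d + t *\<^sub>R e) has_derivative (\<lambda>\<sigma>. \<sigma> *\<^sub>R d)) (at s)"
        and "((\<lambda>s. x + s *\<^sub>R d) has_derivative (\<lambda>\<sigma>. \<sigma> *\<^sub>R d)) (at s)"
        by (auto intro!: derivative_eq_intros)
      then show ?thesis
        unfolding \<psi>_def
        by (intro has_derivative_diff has_derivative_compose[OF _ f])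
    qed
    have lin: "f' y (\<sigma> *\<^sub>R d) = \<sigma> * f' y d" for y \<sigma>
      using linear_scale[OF has_derivative_linear[OF f[of y]], of \<sigma> d] by simp
    have "\<exists>\<xi>. 0 < \<xi> \<and> \<xi> < t \<and>
        \<psi> t - \<psi> 0 = (t - 0) * (f' (x + \<xi> *\<^sub>R d + t *\<^sub>R e) d - f' (x + \<xi> *\<^sub>R d) d)"
    proof (rule MVT2[OF t(1)])
      fix s :: real
      show "(\<psi> has_real_derivative f' (x + s *\<^sub>R d + t *\<^sub>R e) d - f' (x + s *\<^sub>R d) d) (at s)"
        using D\<psi>[of s] unfolding has_field_derivative_def lin
        by (rule has_derivative_eq_rhs) (auto simp: algebra_simps)
    qed
    then obtain \<xi> where \<xi>: "0 < \<xi>" "\<xi> < t"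
      and eq: "\<psi> t - \<psi> 0 = t * (f' (x + \<xi> *\<^sub>R d + t *\<^sub>R e) d - f' (x + \<xi> *\<^sub>R d) d)"
      by auto
    have tc: "t * c < \<delta>" using t c by (simp add: field_simps)
    have n1: "norm (\<xi> *\<^sub>R d) \<le> t * norm d" using \<xi> by (simp add: mult_right_mono)
    have n2: "norm (\<xi> *\<^sub>R d + t *\<^sub>R e) \<le> t * norm d + t * norm e"
      using norm_triangle_ineq[of "\<xi> *\<^sub>R d" "t *\<^sub>R e"] n1 t by simp
    have tc': "t * c = t * norm d + t * norm e + t" by (simp add: c_def algebra_simps)
    have tn: "t * norm d \<ge> 0" "t * norm e \<ge> 0" using t by auto
    have n1: "norm (\<xi> *\<^sub>R d) \<le> t * c" and n2: "norm (\<xi> *\<^sub>R d + t *\<^sub>R e) \<le> t * c"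
      using n1 n2 t tn tc' by linarith+
    have bd': "norm (f' y d - f' x d - A (y - x)) \<le> \<epsilon> * (t * c)" if "norm (y - x) \<le> t * c" for y
      using bd[of y] tc that mult_left_mono[OF that, of \<epsilon>] \<epsilon> by linarith
    have "norm (f' (x + \<xi> *\<^sub>R d) d - f' x d - A (\<xi> *\<^sub>R d)) \<le> \<epsilon> * (t * c)"
      using bd'[of "x + \<xi> *\<^sub>R d"] n1 by simp
    moreover have "norm (f' (x + \<xi> *\<^sub>R d + t *\<^sub>R e) d - f' x d - A (\<xi> *\<^sub>R d + t *\<^sub>R e)) \<le> \<epsilon> * (t * c)"
      using bd'[of "x + \<xi> *\<^sub>R d + t *\<^sub>R e"] n2 by (simp add: add.assoc)
    \<comment> \<open>Subtracting the two linearizations cancels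
      \<open>A (\<xi> *\<^sub>R d)\<close>, so the unknown \<xi> leaves the main term and only
      \<open>t * A e\<close> remains.\<close>
    ultimately have "\<bar>f' (x + \<xi> *\<^sub>R d + t *\<^sub>R e) d - f' (x + \<xi> *\<^sub>R d) d - t * A e\<bar> \<le> 2 * (\<epsilon> * (t * c))"
      unfolding A.add A.scaleR by simp
    also have "2 * (\<epsilon> * (t * c)) = t * (r / 2)" using c by (simp add: \<epsilon>_def)
    finally have b: "\<bar>f' (x + \<xi> *\<^sub>R d + t *\<^sub>R e) d - f' (x + \<xi> *\<^sub>R d) d - t * A e\<bar> \<le> t * (r / 2)" .
    define q where "q = f' (x + \<xi> *\<^sub>R d + t *\<^sub>R e) d - f' (x + \<xi> *\<^sub>R d) d"
    have "(f (x + t *\<^sub>R d + t *\<^sub>R e) - f (x + t *\<^sub>R d) - f (x + t *\<^sub>R e) + f x) / t\<^sup>2 = (\<psi> t - \<psi> 0) / t\<^sup>2"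
      by (simp add: \<psi>_def)
    also have "\<dots> = q / t" using eq t by (simp add: q_def power2_eq_square)
    finally have "dist ((f (x + t *\<^sub>R d + t *\<^sub>R e) - f (x + t *\<^sub>R d) - f (x + t *\<^sub>R e) + f x) / t\<^sup>2) (A e)
        = \<bar>q - t * A e\<bar> / t"
      using t abs_divide[of "q - t * A e" t] by (simp add: dist_real_def diff_divide_distrib)
    also have "\<dots> \<le> r / 2" using b t by (simp add: q_def field_simps)
    also have "\<dots> < r" using r by simp
    finally show ?thesis .
  qed
  have "\<delta> / c > 0" using \<delta> c by simp
  then show "\<forall>\<^sub>F t in at_right 0.
      dist ((f (x + t *\<^sub>R d + t *\<^sub>R e) - f (x + t *\<^sub>R d) - f (x + t *\<^sub>R e) + f x) / t\<^sup>2) (A e) < r"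
    unfolding eventually_at_right_field using main by blast
qed

text \<open>The second difference quotient is symmetric in \<open>d\<close> and \<open>e\<close>;
  reading it in the two orders gives the limits \<open>A e\<close> and \<open>B d\<close>, which
  agree by uniqueness.\<close>

lemma second_derivative_symmetric:
  fixes f :: "'a::real_normed_vector \<Rightarrow> real"
  assumes f: "\<And>x. (f has_derivative f' x) (at x)"
    and A: "((\<lambda>x. f' x d) has_derivative A) (at x)"
    and B: "((\<lambda>x. f' x e) has_derivative B) (at x)"
  shows "A e = B d"
proof (rule tendsto_unique)
  let ?q = "\<lambda>t. (f (x + t *\<^sub>R d + t *\<^sub>R e) - f (x + t *\<^sub>R d) - f (x + t *\<^sub>R e) + f x) / t\<^sup>2"
  show "at_right (0::real) \<noteq> bot" by simp
  show "(?q \<longlongrightarrow> A e) (at_right 0)" by (rule second_difference_tendsto[OF f A])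
  have "?q = (\<lambda>t. (f (x + t *\<^sub>R e + t *\<^sub>R d) - f (x + t *\<^sub>R e) - f (x + t *\<^sub>R d) + f x) / t\<^sup>2)"
    by (simp add: algebra_simps)
  then show "(?q \<longlongrightarrow> B d) (at_right 0)" using second_difference_tendsto[OF f B, of d] by simp
qed

lemma Ck_2D:
  assumes "Ck 2 f UNIV"
  shows "f differentiable at x"
    and "(\<lambda>x. frechet_derivative f (at x) d) differentiable at x"
  using assms by (auto simp: numeral_2_eq_2)

text \<open>Pairing with a fixed \<open>p\<close> reduces the vector-valued case to the real-valued
  one. In the application \<open>p\<close> is a stage costate.\<close>

lemma Ck_2_second_derivative_symmetric:
  fixes f :: "'a::real_normed_vector \<Rightarrow> 'b::real_inner"
  assumes "Ck 2 f UNIV"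
  shows "p \<bullet> frechet_derivative (\<lambda>x. frechet_derivative f (at x) d) (at x) e
       = p \<bullet> frechet_derivative (\<lambda>x. frechet_derivative f (at x) e) (at x) d"
proof (rule second_derivative_symmetric[where f = "\<lambda>x. p \<bullet> f x"
      and f' = "\<lambda>x v. p \<bullet> frechet_derivative f (at x) v"])
  show "((\<lambda>x. p \<bullet> f x) has_derivative (\<lambda>v. p \<bullet> frechet_derivative f (at x) v)) (at x)" for x
    using Ck_2D(1)[OF assms] by (intro has_derivative_inner_right) (simp add: frechet_derivative_works)
  show "((\<lambda>x. p \<bullet> frechet_derivative f (at x) d) has_derivative
      (\<lambda>e. p \<bullet> frechet_derivative (\<lambda>x. frechet_derivative f (at x) d) (at x) e)) (at x)"
    and "((\<lambda>x. p \<bullet> frechet_derivative f (at x) e) has_derivative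
      (\<lambda>d. p \<bullet> frechet_derivative (\<lambda>x. frechet_derivative f (at x) e) (at x) d)) (at x)"
    using Ck_2D(2)[OF assms] by (intro has_derivative_inner_right; simp add: frechet_derivative_works)+
qed

subsection \<open>Partial Jacobians and gradients\<close>

lemma has_derivative_partial_fst:
  assumes "(f has_derivative f') (at (y, u))"
  shows "((\<lambda>x. f (x, u)) has_derivative (\<lambda>e. f' (e, 0))) (at y)"
proof -
  have "((\<lambda>x. (x, u)) has_derivative (\<lambda>e. (e, 0))) (at y)" by (auto intro!: derivative_eq_intros)
  then show ?thesis using has_derivative_compose[where g = f and g' = f'] assms by fastforce
qed

lemma has_derivative_partial_snd:
  assumes "(f has_derivative f') (at (y, u))"
  shows "((\<lambda>v. f (y, v)) has_derivative (\<lambda>e. f' (0, e))) (at u)"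
proof -
  have "((\<lambda>v. (y, v)) has_derivative (\<lambda>e. (0, e))) (at u)" by (auto intro!: derivative_eq_intros)
  then show ?thesis using has_derivative_compose[where g = f and g' = f'] assms by fastforce
qed

text \<open>The bridge from the matrix notation of the scheme to Frechet derivatives: the Jacobian
  matrix represents \<open>f'\<close>, and the transpose moves across the inner product.\<close>

lemma transpose_jacobian_inner:
  fixes f :: "real^'n \<Rightarrow> real^'k"
  assumes "(f has_derivative f') (at x)"
  shows "(transpose (jacobian f (at x)) *v p) \<bullet> e = p \<bullet> f' e"
proof -
  have "f' = (\<lambda>h. jacobian f (at x) *v h)"
    using assms jacobian_works has_derivative_unique differentiableI by blast
  then show ?thesis by (simp add: dot_lmul_matrix)
qed

text \<open>A partial Jacobian is the full derivative restricted to directions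
  \<open>(e, 0)\<close>. Working on the product space treats the \<open>y\<close>- and
  \<open>u\<close>-directions of the second derivatives at once.\<close>

lemma transpose_jac_y_inner:
  assumes "f differentiable at (y, u)"
  shows "(transpose (jac_y f y u) *v p) \<bullet> e = p \<bullet> frechet_derivative f (at (y, u)) (e, 0)"
  unfolding jac_y_def
  by (rule transpose_jacobian_inner has_derivative_partial_fst)+
    (use assms in \<open>simp add: frechet_derivative_works\<close>)

lemma transpose_jac_u_inner:
  assumes "f differentiable at (y, u)"
  shows "(transpose (jac_u f y u) *v p) \<bullet> e = p \<bullet> frechet_derivative f (at (y, u)) (0, e)"
  unfolding jac_u_def
  by (rule transpose_jacobian_inner has_derivative_partial_snd)+
    (use assms in \<open>simp add: frechet_derivative_works\<close>)

lemma grad_eqI: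
  assumes "(F has_derivative (\<lambda>v. c \<bullet> v)) (at x)"
  shows "grad F x = c"
  using frechet_derivative_at[OF assms, symmetric] by (simp add: grad_def inner_axis)

lemma grad_inner:
  assumes "(F has_derivative F') (at x)"
  shows "grad F x \<bullet> v = F' v"
proof -
  have "linear F'" using assms by (rule has_derivative_linear)
  then have "F' (\<Sum>i\<in>UNIV. v $ i *\<^sub>R axis i 1) = (\<Sum>i\<in>UNIV. v $ i * F' (axis i 1))"
    by (simp add: linear_sum linear_scale)
  moreover have "(\<Sum>i\<in>UNIV. v $ i *\<^sub>R axis i 1) = v"
    using basis_expansion[of v] by (simp add: scalar_mult_eq_scaleR)
  ultimately have "F' v = (\<Sum>i\<in>UNIV. v $ i * F' (axis i 1))" by simp
  then show ?thesis
    using frechet_derivative_at[OF assms, symmetric] by (simp add: grad_def inner_vec_def mult.commute)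
qed

subsection \<open>The reduced Hamiltonian system\<close>

lemma hamiltonian_u_inner:
  assumes "f differentiable at (y, u)" "g differentiable at (y, u)"
  shows "hamiltonian_u f g y u p \<bullet> e
       = p \<bullet> (frechet_derivative f (at (y, u)) (0, e) + frechet_derivative g (at (y, u)) (0, e))"
  unfolding hamiltonian_u_def hamiltonian_def
  by (intro grad_inner has_derivative_inner_right has_derivative_add has_derivative_partial_snd)
    (use assms in \<open>simp_all add: frechet_derivative_works\<close>)

text \<open>Envelope argument: the chain rule produces a term through the derivative of \<phi>, but
  it is paired with \<open>H_u\<close>, which vanishes at \<open>u = \<phi> (y, p)\<close>. Only the
  explicit dependence on \<open>y\<close> and \<open>p\<close> survives.\<close>

lemma reduced_hamiltonian_has_derivative:
  assumes f: "f differentiable at (y, \<phi> (y, p))" and g: "g differentiable at (y, \<phi> (y, p))"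
    and \<phi>: "\<phi> differentiable at (y, p)"
    and crit: "hamiltonian_u f g y (\<phi> (y, p)) p = 0"
  shows "(reduced_hamiltonian f g \<phi> has_derivative
     (\<lambda>(v, w). (transpose (jac_y f y (\<phi> (y, p))) *v p + transpose (jac_y g y (\<phi> (y, p))) *v p) \<bullet> v
             + (f (y, \<phi> (y, p)) + g (y, \<phi> (y, p))) \<bullet> w)) (at (y, p))"
proof -
  let ?x = "(y, \<phi> (y, p))"
  let ?f' = "frechet_derivative f (at ?x)" and ?g' = "frechet_derivative g (at ?x)"
  define \<phi>d where "\<phi>d = frechet_derivative \<phi> (at (y, p))"
  have d\<phi>: "(\<phi> has_derivative \<phi>d) (at (y, p))"
    using \<phi> by (simp add: frechet_derivative_works \<phi>d_def)
  have dx: "((\<lambda>z. (fst z, \<phi> z)) has_derivative (\<lambda>v. (fst v, \<phi>d v))) (at (y, p))"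
    by (intro has_derivative_Pair has_derivative_fst has_derivative_ident d\<phi>)
  have f': "(f has_derivative ?f') (at (fst (y, p), \<phi> (y, p)))"
    and g': "(g has_derivative ?g') (at (fst (y, p), \<phi> (y, p)))"
    using f g by (simp_all add: frechet_derivative_works)
  have "((\<lambda>z. snd z \<bullet> (f (fst z, \<phi> z) + g (fst z, \<phi> z))) has_derivative
      (\<lambda>v. snd (y, p) \<bullet> (?f' (fst v, \<phi>d v) + ?g' (fst v, \<phi>d v))
         + snd v \<bullet> (f (fst (y, p), \<phi> (y, p)) + g (fst (y, p), \<phi> (y, p))))) (at (y, p))"
    by (intro has_derivative_inner has_derivative_add has_derivative_snd has_derivative_ident
        has_derivative_compose[OF dx f'] has_derivative_compose[OF dx g'])
  moreover have "(\<lambda>z. snd z \<bullet> (f (fst z, \<phi> z) + g (fst z, \<phi> z))) = reduced_hamiltonian f g \<phi>"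
    by (auto simp: reduced_hamiltonian_def hamiltonian_def)
  moreover have "p \<bullet> (?f' (v, w) + ?g' (v, w))
      = (transpose (jac_y f y (\<phi> (y, p))) *v p + transpose (jac_y g y (\<phi> (y, p))) *v p) \<bullet> v" for v w
  proof -
    \<comment> \<open>Splitting \<open>(v, w)\<close> into \<open>(v, 0) + (0, w)\<close> separates
      the explicit \<open>y\<close>-part from the control part; the latter, paired with
      \<open>p\<close>, is zero by \<open>crit\<close>.\<close>
    have "linear (\<lambda>x. ?f' x + ?g' x)"
      using f g by (intro linear_compose_add linear_frechet_derivative)
    from linear_add[OF this, of "(v, 0)" "(0, w)"]
    have E: "?f' (v, w) + ?g' (v, w) = (?f' (v, 0) + ?g' (v, 0)) + (?f' (0, w) + ?g' (0, w))"
      by simp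
    show ?thesis
      using hamiltonian_u_inner[OF f g, of p w] crit
      unfolding E inner_add_left inner_add_right transpose_jac_y_inner[OF f] transpose_jac_y_inner[OF g]
      by (simp add: inner_add_right)
  qed
  ultimately show ?thesis
    by (simp add: case_prod_unfold inner_commute)
qed

lemma is_hamiltonian_system_reduced:
  assumes f: "\<And>x. f differentiable at x" and g: "\<And>x. g differentiable at x"
    and \<phi>: "\<And>z. z \<in> X \<Longrightarrow> \<phi> differentiable at z"
    and crit: "\<And>y p. (y, p) \<in> X \<Longrightarrow> hamiltonian_u f g y (\<phi> (y, p)) p = 0"
  shows "is_hamiltonian_system X (reduced_hamiltonian f g \<phi>) (reduced_field f g \<phi>)"
  unfolding is_hamiltonian_system_def
proof clarify
  fix y p assume z: "(y, p) \<in> X"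
  note d = reduced_hamiltonian_has_derivative[where f=f and g=g and \<phi>=\<phi>, OF f g \<phi>[OF z] crit[OF z]]
  have "grad (\<lambda>q. reduced_hamiltonian f g \<phi> (y, q)) p = f (y, \<phi> (y, p)) + g (y, \<phi> (y, p))"
    by (rule grad_eqI) (use has_derivative_partial_snd[OF d] in simp)
  moreover have "grad (\<lambda>x. reduced_hamiltonian f g \<phi> (x, p)) y
      = transpose (jac_y f y (\<phi> (y, p))) *v p + transpose (jac_y g y (\<phi> (y, p))) *v p"
    by (rule grad_eqI) (use has_derivative_partial_fst[OF d] in simp)
  ultimately show "reduced_hamiltonian f g \<phi> differentiable at (y, p) \<and>
      reduced_field f g \<phi> (y, p) = (grad (\<lambda>q. reduced_hamiltonian f g \<phi> (y, q)) p,
         - grad (\<lambda>x. reduced_hamiltonian f g \<phi> (x, p)) y)"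
    using d by (auto simp: reduced_field_def differentiable_def)
qed

subsection \<open>Symplecticity\<close>

lemma sum_wedge_eq:
  fixes Y P :: "'a::real_normed_vector \<Rightarrow> real^'k"
  assumes "(Y has_derivative Y') (at z)" "(P has_derivative P') (at z)"
  shows "sum_wedge Y P z v w = Y' v \<bullet> P' w - Y' w \<bullet> P' v"
proof -
  have "frechet_derivative (\<lambda>x. F x $ r) (at z) = (\<lambda>v. F' v $ r)"
    if "(F has_derivative F') (at z)" for F :: "'a \<Rightarrow> real^'k" and F' r
    using bounded_linear.has_derivative[OF bounded_linear_vec_nth that]
    by (rule frechet_derivative_at[symmetric])
  then show ?thesis
    using assms by (simp add: sum_wedge_def wedge_def inner_vec_def sum_subtractf)
qed

text \<open>Applied below to pairs of differentials evaluated at two vectors \<open>v\<close>, \<open>w\<close>, with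
  \<open>B (a, b) (c, d) = a \<bullet> d - b \<bullet> c\<close>.\<close>

lemma bilinear_invariant_of_adj_coeff:
  fixes B :: "'a::real_vector \<Rightarrow> 'b::real_vector \<Rightarrow> real"
    and a' a :: "'s::finite \<Rightarrow> 's \<Rightarrow> real"
  assumes B: "bilinear B"
    and w: "\<And>i. \<omega>' i \<noteq> 0" "\<And>i. \<omega> i \<noteq> 0"
    and Y: "\<And>i. Y i = y + h *\<^sub>R (\<Sum>j\<in>UNIV. a' i j *\<^sub>R F j) + h *\<^sub>R (\<Sum>j\<in>UNIV. a i j *\<^sub>R G j)"
    and y1: "y1 = y + h *\<^sub>R (\<Sum>i\<in>UNIV. \<omega>' i *\<^sub>R F i) + h *\<^sub>R (\<Sum>i\<in>UNIV. \<omega> i *\<^sub>R G i)"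
    and P': "\<And>i. P' i = p - h *\<^sub>R (\<Sum>j\<in>UNIV. adj_coeff \<omega>' \<omega>' a' i j *\<^sub>R L j)
                          - h *\<^sub>R (\<Sum>j\<in>UNIV. adj_coeff \<omega> \<omega>' a' i j *\<^sub>R M j)"
    and P: "\<And>i. P i = p - h *\<^sub>R (\<Sum>j\<in>UNIV. adj_coeff \<omega>' \<omega> a i j *\<^sub>R L j)
                        - h *\<^sub>R (\<Sum>j\<in>UNIV. adj_coeff \<omega> \<omega> a i j *\<^sub>R M j)"
    and p1: "p1 = p - h *\<^sub>R (\<Sum>i\<in>UNIV. \<omega>' i *\<^sub>R L i) - h *\<^sub>R (\<Sum>i\<in>UNIV. \<omega> i *\<^sub>R M i)"
    and stage: "\<And>i. \<omega>' i * B (F i) (P' i) + \<omega> i * B (G i) (P i)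
                    = \<omega>' i * B (Y i) (L i) + \<omega> i * B (Y i) (M i)"
  shows "B y1 p1 = B y p"
proof -
  have suml: "B (\<Sum>j\<in>UNIV. x j) z = (\<Sum>j\<in>UNIV. B (x j) z)" for x :: "'s \<Rightarrow> 'a" and z
    using B unfolding bilinear_def by (auto intro: linear_sum)
  have sumr: "B z (\<Sum>j\<in>UNIV. x j) = (\<Sum>j\<in>UNIV. B z (x j))" for x :: "'s \<Rightarrow> 'b" and z
    using B unfolding bilinear_def by (auto intro: linear_sum)
  note bil = bilinear_ladd[OF B] bilinear_radd[OF B] bilinear_lsub[OF B] bilinear_rsub[OF B]
    bilinear_lmul[OF B] bilinear_rmul[OF B] suml sumr
  \<comment> \<open>Since \<open>v i \<noteq> 0\<close>, \<open>v i * adj_coeff w v b i j\<close>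
    equals \<open>v i * w j - w j * b j i\<close>. Exchanging the summation indices turns the second
    sum into exactly the subtracted part.\<close>
  have cross: "(\<Sum>i\<in>UNIV. v i * (\<Sum>j\<in>UNIV. adj_coeff w v b i j * c i j))
        + (\<Sum>i\<in>UNIV. w i * (\<Sum>j\<in>UNIV. b i j * c j i))
      = (\<Sum>i\<in>UNIV. v i * (\<Sum>j\<in>UNIV. w j * c i j))"
    if "\<And>i. v i \<noteq> 0" for v w :: "'s \<Rightarrow> real" and b c
  proof -
    have "(\<Sum>i\<in>UNIV. w i * (\<Sum>j\<in>UNIV. b i j * c j i)) = (\<Sum>i\<in>UNIV. \<Sum>j\<in>UNIV. w j * b j i * c i j)"
      unfolding sum_distrib_left mult.assoc by (rule sum.swap)
    then show ?thesis
      using that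
      by (simp add: sum_distrib_left adj_coeff_def flip: sum.distrib)
        (intro sum.cong refl, simp add: field_simps)
  qed
  have "(\<Sum>i\<in>UNIV. \<omega>' i * B (F i) (P' i) + \<omega> i * B (G i) (P i))
      = (\<Sum>i\<in>UNIV. \<omega>' i * B (Y i) (L i) + \<omega> i * B (Y i) (M i))"
    by (simp only: stage)
  then have S: "(\<Sum>i\<in>UNIV. \<omega>' i * B (F i) (P' i)) + (\<Sum>i\<in>UNIV. \<omega> i * B (G i) (P i))
      - (\<Sum>i\<in>UNIV. \<omega>' i * B (Y i) (L i)) - (\<Sum>i\<in>UNIV. \<omega> i * B (Y i) (M i)) = 0"
    by (simp only: sum.distrib)
  \<comment> \<open>Inserting the relations for \<open>P'\<close>, \<open>P\<close> and
    \<open>Y\<close> into the stage sums yields single sums against \<open>p\<close> or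
    \<open>y\<close>, and double sums with a factor \<open>h\<close> that pair up as in
    \<open>cross\<close>.\<close>
  have e1: "(\<Sum>i\<in>UNIV. \<omega>' i * B (F i) (P' i)) = (\<Sum>i\<in>UNIV. \<omega>' i * B (F i) p)
      - h * (\<Sum>i\<in>UNIV. \<omega>' i * (\<Sum>j\<in>UNIV. adj_coeff \<omega>' \<omega>' a' i j * B (F i) (L j)))
      - h * (\<Sum>i\<in>UNIV. \<omega>' i * (\<Sum>j\<in>UNIV. adj_coeff \<omega> \<omega>' a' i j * B (F i) (M j)))"
    by (simp add: P' bil right_diff_distrib sum_subtractf sum_distrib_left mult.left_commute)
  have e2: "(\<Sum>i\<in>UNIV. \<omega> i * B (G i) (P i)) = (\<Sum>i\<in>UNIV. \<omega> i * B (G i) p)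
      - h * (\<Sum>i\<in>UNIV. \<omega> i * (\<Sum>j\<in>UNIV. adj_coeff \<omega>' \<omega> a i j * B (G i) (L j)))
      - h * (\<Sum>i\<in>UNIV. \<omega> i * (\<Sum>j\<in>UNIV. adj_coeff \<omega> \<omega> a i j * B (G i) (M j)))"
    by (simp add: P bil right_diff_distrib sum_subtractf sum_distrib_left mult.left_commute)
  have e3: "(\<Sum>i\<in>UNIV. w i * B (Y i) (N i)) = (\<Sum>i\<in>UNIV. w i * B y (N i))
      + h * (\<Sum>i\<in>UNIV. w i * (\<Sum>j\<in>UNIV. a' i j * B (F j) (N i)))
      + h * (\<Sum>i\<in>UNIV. w i * (\<Sum>j\<in>UNIV. a i j * B (G j) (N i)))" for w N
    by (simp add: Y bil distrib_left sum.distrib sum_distrib_left mult.left_commute)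
  note cr = cross[where v=\<omega>' and w=\<omega>' and b=a' and c="\<lambda>i j. B (F i) (L j)", OF w(1)]
    cross[where v=\<omega>' and w=\<omega> and b=a' and c="\<lambda>i j. B (F i) (M j)", OF w(1)]
    cross[where v=\<omega> and w=\<omega>' and b=a and c="\<lambda>i j. B (G i) (L j)", OF w(2)]
    cross[where v=\<omega> and w=\<omega> and b=a and c="\<lambda>i j. B (G i) (M j)", OF w(2)]
  have l: "B (\<Sum>i\<in>UNIV. v i *\<^sub>R x i) q = (\<Sum>i\<in>UNIV. v i * B (x i) q)" for v :: "'s \<Rightarrow> real" and x q
    by (simp add: bilinear_lmul[OF B] suml)
  have r: "B q (\<Sum>i\<in>UNIV. v i *\<^sub>R x i) = (\<Sum>i\<in>UNIV. v i * B q (x i))" for v :: "'s \<Rightarrow> real" and x q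
    by (simp add: bilinear_rmul[OF B] sumr)
  have dbl: "B (\<Sum>i\<in>UNIV. v i *\<^sub>R x i) (\<Sum>j\<in>UNIV. w j *\<^sub>R q j)
      = (\<Sum>i\<in>UNIV. v i * (\<Sum>j\<in>UNIV. w j * B (x i) (q j)))" for v w :: "'s \<Rightarrow> real" and x q
    by (subst l) (simp only: r)
  \<comment> \<open>The single sums form the first-order part of the difference. Its four double
    sums of order \<open>h^2\<close> are rewritten backwards through \<open>cross\<close>, giving
    the double sums of \<open>e1\<close>, \<open>e2\<close> and \<open>e3\<close>.\<close>
  have "B y1 p1 - B y p
      = h * ((\<Sum>i\<in>UNIV. \<omega>' i * B (F i) (P' i)) + (\<Sum>i\<in>UNIV. \<omega> i * B (G i) (P i))
      - (\<Sum>i\<in>UNIV. \<omega>' i * B (Y i) (L i)) - (\<Sum>i\<in>UNIV. \<omega> i * B (Y i) (M i)))"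
    unfolding y1 p1 e1 e2 e3 bilinear_ladd[OF B] bilinear_rsub[OF B] bilinear_lmul[OF B]
      bilinear_rmul[OF B] dbl
    unfolding cr[symmetric] l r
    by (simp add: algebra_simps)
  then show ?thesis using S by simp
qed

section \<open>Differentiability of the adjoint terms and the identity at a single stage\<close>

text \<open>The component along \<open>b\<close> is \<open>P z\<close> paired with the derivative of
  \<open>f\<close> at \<open>(Y z, u z)\<close> in the fixed direction \<open>(b, 0)\<close>. For
  \<open>f\<close> of class C^2 that directional derivative is differentiable in its base point, so
  the chain rule applies.\<close>

lemma transpose_jac_y_differentiable:
  fixes f :: "(real^'k) \<times> (real^'m) \<Rightarrow> real^'k"
  assumes f: "Ck 2 f UNIV"
    and Y: "Y differentiable at z" and u: "u differentiable at z" and P: "P differentiable at z"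
  shows "(\<lambda>z. transpose (jac_y f (Y z) (u z)) *v P z) differentiable at z"
proof (subst differentiable_componentwise_within, intro ballI)
  fix b :: "real^'k" assume "b \<in> Basis"
  have x: "(\<lambda>z. (Y z, u z)) differentiable at z" using Y u by simp
  have "(\<lambda>z. frechet_derivative f (at (Y z, u z)) (b, 0)) differentiable at z"
    using differentiable_chain_at[OF x Ck_2D(2)[OF f]] by (simp add: o_def)
  then show "(\<lambda>z. (transpose (jac_y f (Y z) (u z)) *v P z) \<bullet> b) differentiable at z"
    unfolding transpose_jac_y_inner[OF Ck_2D(1)[OF f]] using P by simp
qed

text \<open>For fixed \<open>e\<close> both sides of \<open>key\<close> below are functions of \<open>z\<close>; this is where the control condition
  enters.  Their derivatives in the direction \<open>w\<close> at \<open>e = (Y' v, u' v)\<close>, antisymmetrized in \<open>v\<close> and \<open>w\<close>,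
  give the claim, since the second derivatives of \<open>f\<close> and \<open>g\<close> drop out by symmetry.\<close>

lemma stage_identity:
  assumes f: "Ck 2 f UNIV" and g: "Ck 2 g UNIV"
    and D: "open D" "z \<in> D"
    and dY: "(Y has_derivative Y') (at z)" and du: "(u has_derivative u') (at z)"
    and dP: "(P has_derivative Pd) (at z)" and dQ: "(Q has_derivative Qd) (at z)"
    and dF: "((\<lambda>z. f (Y z, u z)) has_derivative F') (at z)"
    and dG: "((\<lambda>z. g (Y z, u z)) has_derivative G') (at z)"
    and dL: "((\<lambda>z. transpose (jac_y f (Y z) (u z)) *v Q z) has_derivative L') (at z)"
    and dM: "((\<lambda>z. transpose (jac_y g (Y z) (u z)) *v P z) has_derivative M') (at z)"
    and ctrl: "\<And>z. z \<in> D \<Longrightarrow> control_condition f g c' c (Y z) (u z) (P z) (Q z)"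
  shows "c' * (F' v \<bullet> Qd w - F' w \<bullet> Qd v) + c * (G' v \<bullet> Pd w - G' w \<bullet> Pd v)
       = c' * (Y' v \<bullet> L' w - Y' w \<bullet> L' v) + c * (Y' v \<bullet> M' w - Y' w \<bullet> M' v)"
proof -
  define f1 where "f1 x = frechet_derivative f (at x)" for x
  define g1 where "g1 x = frechet_derivative g (at x)" for x
  \<comment> \<open>\<open>f2 x e d\<close> is the second derivative with \<open>e\<close> the
    direction of the inner differentiation and \<open>d\<close> that of the outer one.\<close>
  define f2 where "f2 x e = frechet_derivative (\<lambda>x. f1 x e) (at x)" for x e
  define g2 where "g2 x e = frechet_derivative (\<lambda>x. g1 x e) (at x)" for x e
  define x where "x z = (Y z, u z)" for z
  define x' where "x' v = (Y' v, u' v)" for v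
  have dx: "(x has_derivative x') (at z)"
    using has_derivative_Pair[OF dY du] by (simp add: x_def[abs_def] x'_def[abs_def])
  have f1: "(f has_derivative f1 x) (at x)" and g1: "(g has_derivative g1 x) (at x)" for x
    using Ck_2D(1)[OF f] Ck_2D(1)[OF g] by (simp_all add: f1_def g1_def frechet_derivative_works)
  have f2: "((\<lambda>x. f1 x e) has_derivative f2 x e) (at x)"
    and g2: "((\<lambda>x. g1 x e) has_derivative g2 x e) (at x)" for x e
    using Ck_2D(2)[OF f] Ck_2D(2)[OF g]
    by (simp_all add: f1_def g1_def f2_def g2_def frechet_derivative_works)
  have F': "F' = (\<lambda>v. f1 (x z) (x' v))" and G': "G' = (\<lambda>v. g1 (x z) (x' v))"
    using has_derivative_unique[OF dF] has_derivative_unique[OF dG]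
      has_derivative_compose[OF dx f1] has_derivative_compose[OF dx g1]
    by (simp_all add: x_def)
  have key: "c' * (Q z \<bullet> f1 (x z) e) + c * (P z \<bullet> g1 (x z) e)
      = c' * ((transpose (jac_y f (Y z) (u z)) *v Q z) \<bullet> fst e)
      + c * ((transpose (jac_y g (Y z) (u z)) *v P z) \<bullet> fst e)" if "z \<in> D" for z e
  proof -
    \<comment> \<open>The control condition concerns only the \<open>u\<close>-directions, so
      \<open>e\<close> is split; the \<open>(0, snd e)\<close> part cancels in the weighted sum, and
      the \<open>(fst e, 0)\<close> part gives the partial Jacobians in \<open>y\<close>.\<close>
    have split: "f1 (x z) e = f1 (x z) (fst e, 0) + f1 (x z) (0, snd e)"
      "g1 (x z) e = g1 (x z) (fst e, 0) + g1 (x z) (0, snd e)"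
      using linear_add[OF has_derivative_linear[OF f1], of "x z" "(fst e, 0)" "(0, snd e)"]
        linear_add[OF has_derivative_linear[OF g1], of "x z" "(fst e, 0)" "(0, snd e)"]
      by simp_all
    have "(c' *\<^sub>R (transpose (jac_u f (Y z) (u z)) *v Q z)
        + c *\<^sub>R (transpose (jac_u g (Y z) (u z)) *v P z)) \<bullet> snd e = 0"
      using ctrl[OF that] by (simp add: control_condition_def)
    then have "c' * (Q z \<bullet> f1 (x z) (0, snd e)) + c * (P z \<bullet> g1 (x z) (0, snd e)) = 0"
      unfolding inner_add_left inner_scaleR_left transpose_jac_u_inner[OF Ck_2D(1)[OF f]]
        transpose_jac_u_inner[OF Ck_2D(1)[OF g]] f1_def g1_def x_def .
    then show ?thesis
      unfolding split transpose_jac_y_inner[OF Ck_2D(1)[OF f]] transpose_jac_y_inner[OF Ck_2D(1)[OF g]]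
      by (simp add: f1_def g1_def x_def inner_add_right algebra_simps)
  qed
  have deriv: "c' * (Q z \<bullet> f2 (x z) e (x' w) + Qd w \<bullet> f1 (x z) e)
        + c * (P z \<bullet> g2 (x z) e (x' w) + Pd w \<bullet> g1 (x z) e)
      = c' * (L' w \<bullet> fst e) + c * (M' w \<bullet> fst e)" for e w
  proof -
    have l: "((\<lambda>z. c' * (Q z \<bullet> f1 (x z) e) + c * (P z \<bullet> g1 (x z) e)) has_derivative
       (\<lambda>w. c' * (Q z \<bullet> f2 (x z) e (x' w) + Qd w \<bullet> f1 (x z) e)
        + c * (P z \<bullet> g2 (x z) e (x' w) + Pd w \<bullet> g1 (x z) e))) (at z)"
      by (intro has_derivative_add has_derivative_mult_right has_derivative_inner dP dQ
          has_derivative_compose[OF dx f2] has_derivative_compose[OF dx g2])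
    have r: "((\<lambda>z. c' * ((transpose (jac_y f (Y z) (u z)) *v Q z) \<bullet> fst e)
      + c * ((transpose (jac_y g (Y z) (u z)) *v P z) \<bullet> fst e)) has_derivative
       (\<lambda>w. c' * (L' w \<bullet> fst e) + c * (M' w \<bullet> fst e))) (at z)"
      by (intro has_derivative_add has_derivative_mult_right has_derivative_inner_left dL dM)
    show ?thesis
      using has_derivative_unique[OF has_derivative_transform_within_open[OF l D key] r]
      by (rule fun_cong)
  qed
  have sym: "q \<bullet> f2 y e d = q \<bullet> f2 y d e" "q \<bullet> g2 y e d = q \<bullet> g2 y d e" for q y d e
    unfolding f2_def f1_def g2_def g1_def
    using Ck_2_second_derivative_symmetric[OF f] Ck_2_second_derivative_symmetric[OF g] by blast+
  \<comment> \<open>For \<open>e = x' v\<close> the terms \<open>f1 (x z) e\<close> and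
    \<open>fst e\<close> are \<open>F' v\<close> and \<open>Y' v\<close>. Subtracting the same
    identity with \<open>v\<close> and \<open>w\<close> exchanged removes \<open>f2\<close> and
    \<open>g2\<close> by \<open>sym\<close>.\<close>
  show ?thesis
    using deriv[of "x' v" w] deriv[of "x' w" v] sym(1)[of "Q z" "x z" "x' v" "x' w"]
      sym(2)[of "P z" "x z" "x' v" "x' w"]
    unfolding F' G' by (simp add: x'_def inner_commute algebra_simps)
qed

section \<open>Differentials of the scheme and of the one-step map\<close>

text \<open>Equality on an open neighbourhood of \<open>z\<close> is what permits differentiating an
  equation of the scheme at \<open>z\<close>.\<close>

lemma has_derivative_equation:
  assumes "(A has_derivative A') (at z)" "(B has_derivative B') (at z)"
    and "open D" "z \<in> D" "\<And>z. z \<in> D \<Longrightarrow> A z = B z"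
  shows "A' = B'"
  using has_derivative_transform_within_open[OF assms(1,3,4,5)] assms(2)
  by (rule has_derivative_unique)

text \<open>The differentiated equations, evaluated at two test vectors, have the shape required by
  \<open>bilinear_invariant_of_adj_coeff\<close>; its stage hypothesis comes from
  \<open>stage_identity\<close>.\<close>

lemma symplectic_step:
  fixes f g :: "(real^'k) \<times> (real^'m) \<Rightarrow> real^'k"
    and a' a :: "'s::finite \<Rightarrow> 's \<Rightarrow> real"
    and Y P P' :: "'s \<Rightarrow> (real^'k) \<times> (real^'k) \<Rightarrow> real^'k"
  assumes f: "Ck 2 f UNIV" and g: "Ck 2 g UNIV"
    and w: "\<And>i. \<omega>' i \<noteq> 0" "\<And>i. \<omega> i \<noteq> 0"
    and D: "open D" "z \<in> D"
    and Y: "\<And>i. Y i differentiable at z" and P: "\<And>i. P i differentiable at z"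
    and P': "\<And>i. P' i differentiable at z" and u: "\<And>i. u i differentiable at z"
    and yn: "ynext differentiable at z" and pn: "pnext differentiable at z"
    and state: "\<And>z. z \<in> D \<Longrightarrow> state_step f g h a' a \<omega>' \<omega> (fst z) (\<lambda>i. Y i z) (\<lambda>i. u i z) (ynext z)"
    and adj: "\<And>z. z \<in> D \<Longrightarrow> adjoint_step f g h (adj_coeff \<omega>' \<omega>' a') (adj_coeff \<omega> \<omega>' a')
        (adj_coeff \<omega>' \<omega> a) (adj_coeff \<omega> \<omega> a) \<omega>' \<omega> (\<lambda>i. Y i z) (\<lambda>i. u i z) (snd z)
        (\<lambda>i. P' i z) (\<lambda>i. P i z) (pnext z)"
    and ctrl: "\<And>k z. z \<in> D \<Longrightarrow> control_condition f g (\<omega>' k) (\<omega> k) (Y k z) (u k z) (P k z) (P' k z)"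
  shows "sum_wedge ynext pnext z = sum_wedge fst snd z"
proof (intro ext)
  fix v w :: "(real^'k) \<times> (real^'k)"
  define d where "d F = frechet_derivative F (at z)" for F :: "(real^'k) \<times> (real^'k) \<Rightarrow> real^'k"
  define F where "F i = (\<lambda>z. f (Y i z, u i z))" for i
  define G where "G i = (\<lambda>z. g (Y i z, u i z))" for i
  define L where "L i = (\<lambda>z. transpose (jac_y f (Y i z) (u i z)) *v P' i z)" for i
  define M where "M i = (\<lambda>z. transpose (jac_y g (Y i z) (u i z)) *v P i z)" for i
  have dd: "(A has_derivative d A) (at z)" if "A differentiable at z" for A
    using that by (simp add: d_def frechet_derivative_works)
  have x: "(\<lambda>z. (Y i z, u i z)) differentiable at z" for i
    using Y u by simp
  have dF: "(F i has_derivative d (F i)) (at z)" and dG: "(G i has_derivative d (G i)) (at z)" for i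
    unfolding F_def G_def
    using differentiable_chain_at[OF x Ck_2D(1)[OF f]] differentiable_chain_at[OF x Ck_2D(1)[OF g]]
    by (auto simp: o_def intro: dd)
  have dL: "(L i has_derivative d (L i)) (at z)" and dM: "(M i has_derivative d (M i)) (at z)" for i
    unfolding L_def M_def
    using transpose_jac_y_differentiable[OF f Y u P'] transpose_jac_y_differentiable[OF g Y u P]
    by (auto intro: dd)
  have dfst: "(fst has_derivative fst) (at z)" and dsnd: "(snd has_derivative snd) (at z)"
    by (rule bounded_linear_imp_has_derivative bounded_linear_fst bounded_linear_snd)+
  \<comment> \<open>The right-hand sides of the state equations share this form and those of the
    adjoint equations the form of \<open>minus\<close>, so each is differentiated once for arbitrary
    coefficients.\<close>
  have plus: "((\<lambda>z. A z + h *\<^sub>R (\<Sum>j\<in>UNIV. b j *\<^sub>R S j z) + h *\<^sub>R (\<Sum>j\<in>UNIV. c j *\<^sub>R T j z)) has_derivative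
      (\<lambda>v. A' v + h *\<^sub>R (\<Sum>j\<in>UNIV. b j *\<^sub>R d (S j) v) + h *\<^sub>R (\<Sum>j\<in>UNIV. c j *\<^sub>R d (T j) v))) (at z)"
    if "(A has_derivative A') (at z)" "\<And>j. (S j has_derivative d (S j)) (at z)"
       "\<And>j. (T j has_derivative d (T j)) (at z)" for A A' S T and b c :: "'s \<Rightarrow> real"
    by (intro has_derivative_add has_derivative_scaleR_right has_derivative_sum that)
  have minus: "((\<lambda>z. A z - h *\<^sub>R (\<Sum>j\<in>UNIV. b j *\<^sub>R S j z) - h *\<^sub>R (\<Sum>j\<in>UNIV. c j *\<^sub>R T j z)) has_derivative
      (\<lambda>v. A' v - h *\<^sub>R (\<Sum>j\<in>UNIV. b j *\<^sub>R d (S j) v) - h *\<^sub>R (\<Sum>j\<in>UNIV. c j *\<^sub>R d (T j) v))) (at z)"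
    if "(A has_derivative A') (at z)" "\<And>j. (S j has_derivative d (S j)) (at z)"
       "\<And>j. (T j has_derivative d (T j)) (at z)" for A A' S T and b c :: "'s \<Rightarrow> real"
    by (intro has_derivative_diff has_derivative_scaleR_right has_derivative_sum that)
  have Yd: "d (Y i) = (\<lambda>v. fst v + h *\<^sub>R (\<Sum>j\<in>UNIV. a' i j *\<^sub>R d (F j) v)
      + h *\<^sub>R (\<Sum>j\<in>UNIV. a i j *\<^sub>R d (G j) v))" for i
    by (rule has_derivative_equation[OF dd[OF Y] plus[OF dfst dF dG] D])
      (use state in \<open>unfold state_step_def F_def G_def, blast\<close>)
  have y1d: "d ynext = (\<lambda>v. fst v + h *\<^sub>R (\<Sum>i\<in>UNIV. \<omega>' i *\<^sub>R d (F i) v)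
      + h *\<^sub>R (\<Sum>i\<in>UNIV. \<omega> i *\<^sub>R d (G i) v))"
    by (rule has_derivative_equation[OF dd[OF yn] plus[OF dfst dF dG] D])
      (use state in \<open>unfold state_step_def F_def G_def, blast\<close>)
  have P'd: "d (P' i) = (\<lambda>v. snd v - h *\<^sub>R (\<Sum>j\<in>UNIV. adj_coeff \<omega>' \<omega>' a' i j *\<^sub>R d (L j) v)
      - h *\<^sub>R (\<Sum>j\<in>UNIV. adj_coeff \<omega> \<omega>' a' i j *\<^sub>R d (M j) v))" for i
    by (rule has_derivative_equation[OF dd[OF P'] minus[OF dsnd dL dM] D])
      (use adj in \<open>unfold adjoint_step_def L_def M_def, blast\<close>)
  have Pd: "d (P i) = (\<lambda>v. snd v - h *\<^sub>R (\<Sum>j\<in>UNIV. adj_coeff \<omega>' \<omega> a i j *\<^sub>R d (L j) v)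
      - h *\<^sub>R (\<Sum>j\<in>UNIV. adj_coeff \<omega> \<omega> a i j *\<^sub>R d (M j) v))" for i
    by (rule has_derivative_equation[OF dd[OF P] minus[OF dsnd dL dM] D])
      (use adj in \<open>unfold adjoint_step_def L_def M_def, blast\<close>)
  have p1d: "d pnext = (\<lambda>v. snd v - h *\<^sub>R (\<Sum>i\<in>UNIV. \<omega>' i *\<^sub>R d (L i) v)
      - h *\<^sub>R (\<Sum>i\<in>UNIV. \<omega> i *\<^sub>R d (M i) v))"
    by (rule has_derivative_equation[OF dd[OF pn] minus[OF dsnd dL dM] D])
      (use adj in \<open>unfold adjoint_step_def L_def M_def, blast\<close>)
  \<comment> \<open>\<open>B (pr A) (pr C)\<close> is the value on \<open>(v, w)\<close> of the
    two-form built from the differentials \<open>A\<close> and \<open>C\<close>.\<close>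
  define B :: "(real^'k) \<times> (real^'k) \<Rightarrow> (real^'k) \<times> (real^'k) \<Rightarrow> real"
    where "B s t = fst s \<bullet> snd t - snd s \<bullet> fst t" for s t
  define pr where "pr A = (A v, A w)" for A :: "(real^'k) \<times> (real^'k) \<Rightarrow> real^'k"
  have "B (pr (d ynext)) (pr (d pnext)) = B (pr fst) (pr snd)"
  proof (rule bilinear_invariant_of_adj_coeff[where Y = "\<lambda>i. pr (d (Y i))" and F = "\<lambda>i. pr (d (F i))"
        and G = "\<lambda>i. pr (d (G i))" and L = "\<lambda>i. pr (d (L i))" and M = "\<lambda>i. pr (d (M i))"
        and P = "\<lambda>i. pr (d (P i))" and P' = "\<lambda>i. pr (d (P' i))" and h = h and a = a and a' = a'
        and \<omega> = \<omega> and \<omega>' = \<omega>'])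
    show "bilinear B"
      by (auto simp: bilinear_def B_def linear_iff algebra_simps inner_simps)
    show "\<omega>' i * B (pr (d (F i))) (pr (d (P' i))) + \<omega> i * B (pr (d (G i))) (pr (d (P i)))
        = \<omega>' i * B (pr (d (Y i))) (pr (d (L i))) + \<omega> i * B (pr (d (Y i))) (pr (d (M i)))" for i
    proof -
      \<comment> \<open>\<open>d\<close> is typed for functions into \<open>real^'k\<close>; the
        control takes values in \<open>real^'m\<close>, so its derivative is obtained
        separately.\<close>
      obtain u' where u': "(u i has_derivative u') (at z)" using u by (auto simp: differentiable_def)
      show ?thesis
        using stage_identity[where v = v and w = w, OF f g D dd[OF Y] u' dd[OF P] dd[OF P']
            dF[unfolded F_def] dG[unfolded G_def] dL[unfolded L_def] dM[unfolded M_def] ctrl]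
        by (simp add: B_def pr_def F_def L_def M_def G_def)
    qed
  qed (use assms(3,4) in \<open>simp_all add: pr_def Yd y1d P'd Pd p1d scaleR_sum_right prod_eq_iff fst_sum snd_sum\<close>)
  then show "sum_wedge ynext pnext z v w = sum_wedge fst snd z v w"
    by (simp add: sum_wedge_eq[OF dd[OF yn] dd[OF pn]] sum_wedge_eq[OF dfst dsnd] B_def pr_def)
qed

text \<open>Being a scheme for the reduced system is made precise in three conjuncts: the displayed
  field is Hamiltonian, it is the diagonal \<open>p' = p\<close> of a split field, and a step is an
  additive partitioned Runge-Kutta step for that splitting. Symplecticity is the fourth.\<close>

theorem theorem3p2:
  fixes f g :: "(real^'k) \<times> (real^'m) \<Rightarrow> real^'k"
    and h :: real
    and a' a :: "'s::finite \<Rightarrow> 's \<Rightarrow> real"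
    and \<omega>' \<omega> :: "'s \<Rightarrow> real"
    and \<alpha>' \<alpha> \<beta>' \<beta> :: "'s \<Rightarrow> 's \<Rightarrow> real"
    and \<phi> :: "(real^'k) \<times> (real^'k) \<Rightarrow> real^'m"
    and \<phi>' :: "(real^'k) \<times> (real^'k) \<times> (real^'k) \<Rightarrow> real^'m"
    and X :: "((real^'k) \<times> (real^'k)) set"
    and W :: "(((real^'k) \<times> (real^'k)) \<times> (real^'m)) set"
    and X' :: "((real^'k) \<times> (real^'k) \<times> (real^'k)) set"
    and W' :: "(((real^'k) \<times> (real^'k) \<times> (real^'k)) \<times> (real^'m)) set"
    and D :: "((real^'k) \<times> (real^'k)) set"
    and Y P P' :: "'s \<Rightarrow> (real^'k) \<times> (real^'k) \<Rightarrow> real^'k"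
    and u :: "'s \<Rightarrow> (real^'k) \<times> (real^'k) \<Rightarrow> real^'m"
    and ynext pnext :: "(real^'k) \<times> (real^'k) \<Rightarrow> real^'k"
  assumes "Ck 2 f UNIV" and "Ck 2 g UNIV"
    and "h > 0"
    and "\<And>i. \<omega>' i \<noteq> 0" and "\<And>i. \<omega> i \<noteq> 0"
    and "\<alpha>' = adj_coeff \<omega>' \<omega>' a'" and "\<alpha> = adj_coeff \<omega> \<omega>' a'"
    and "\<beta>' = adj_coeff \<omega>' \<omega> a" and "\<beta> = adj_coeff \<omega> \<omega> a"
    and "\<And>y p v. ((y, p), v) \<in> W \<Longrightarrow> invertible (hamiltonian_uu f g y v p)"
    and "locally_solved_by (\<lambda>(y, p) v. hamiltonian_u f g y v p = 0) W X \<phi>"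
    and "\<And>k. locally_solved_by
              (\<lambda>(y, p, p') v. control_condition f g (\<omega>' k) (\<omega> k) y v p p') W' X' \<phi>'"
    and "\<And>y p. (y, p) \<in> X \<Longrightarrow> (y, p, p) \<in> X' \<and> \<phi>' (y, p, p) = \<phi> (y, p)"
    and "open D"
    and "\<And>i. Ck 1 (Y i) D" and "\<And>i. Ck 1 (P i) D" and "\<And>i. Ck 1 (P' i) D"
    and "\<And>i. Ck 1 (u i) D" and "Ck 1 ynext D" and "Ck 1 pnext D"
    and "\<And>i z. z \<in> D \<Longrightarrow> ((Y i z, P i z, P' i z), u i z) \<in> W'"
    and "\<And>y p. (y, p) \<in> D \<Longrightarrow>
           state_step f g h a' a \<omega>' \<omega> y
             (\<lambda>i. Y i (y, p)) (\<lambda>i. u i (y, p)) (ynext (y, p))"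
    and "\<And>y p. (y, p) \<in> D \<Longrightarrow>
           adjoint_step f g h \<alpha>' \<alpha> \<beta>' \<beta> \<omega>' \<omega> (\<lambda>i. Y i (y, p)) (\<lambda>i. u i (y, p)) p
             (\<lambda>i. P' i (y, p)) (\<lambda>i. P i (y, p)) (pnext (y, p))"
    and "\<And>k z. z \<in> D \<Longrightarrow> control_condition f g (\<omega>' k) (\<omega> k) (Y k z) (u k z) (P k z) (P' k z)"
    and "\<And>i. \<omega>' i = \<omega> i"
  shows "is_hamiltonian_system X (reduced_hamiltonian f g \<phi>) (reduced_field f g \<phi>)
    \<and> (\<forall>(y, p)\<in>X. f_part f \<phi>' (y, p, p) + g_part g \<phi>' (y, p, p) = reduced_field f g \<phi> (y, p))
    \<and> (\<forall>z\<in>D. additive_prk_step (f_part f \<phi>') (g_part g \<phi>') h a' a \<alpha>' \<alpha> \<beta>' \<beta> \<omega>' \<omega>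
                z (\<lambda>i. Y i z) (\<lambda>i. P i z) (\<lambda>i. P' i z) (ynext z, pnext z))
    \<and> (\<forall>z\<in>D. sum_wedge ynext pnext z = sum_wedge fst snd z)"
proof (intro conjI)
  have f: "f differentiable at x" and g: "g differentiable at x" for x
    by (rule Ck_2D(1)[OF assms(1)] Ck_2D(1)[OF assms(2)])+
  show "is_hamiltonian_system X (reduced_hamiltonian f g \<phi>) (reduced_field f g \<phi>)"
    using assms(11)
    by (intro is_hamiltonian_system_reduced f g) (auto simp: locally_solved_by_def)
  show "\<forall>(y, p)\<in>X. f_part f \<phi>' (y, p, p) + g_part g \<phi>' (y, p, p) = reduced_field f g \<phi> (y, p)"
    using assms(13) by (auto simp: f_part_def g_part_def reduced_field_def)
  \<comment> \<open>The stage values lie in \<open>W'\<close>, where the control condition has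
    \<phi>' as its only solution.\<close>
  have u: "u i z = \<phi>' (Y i z, P i z, P' i z)" if "z \<in> D" for i z
    using assms(12)[of i] assms(21)[OF that, of i] assms(24)[OF that, of i]
    by (auto simp: locally_solved_by_def)
  have state: "state_step f g h a' a \<omega>' \<omega> (fst z) (\<lambda>i. Y i z) (\<lambda>i. u i z) (ynext z)"
    and adj: "adjoint_step f g h \<alpha>' \<alpha> \<beta>' \<beta> \<omega>' \<omega> (\<lambda>i. Y i z) (\<lambda>i. u i z) (snd z)
        (\<lambda>i. P' i z) (\<lambda>i. P i z) (pnext z)" if "z \<in> D" for z
    using assms(22,23)[of "fst z" "snd z"] that by simp_all
  show "\<forall>z\<in>D. additive_prk_step (f_part f \<phi>') (g_part g \<phi>') h a' a \<alpha>' \<alpha> \<beta>' \<beta> \<omega>' \<omega>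
                z (\<lambda>i. Y i z) (\<lambda>i. P i z) (\<lambda>i. P' i z) (ynext z, pnext z)"
  proof
    fix z assume z: "z \<in> D"
    \<comment> \<open>With the control eliminated, the first components of the split field are
      \<open>f\<close> and \<open>g\<close>, and the second ones are the negated adjoint terms. This
      sign turns the subtractions of the adjoint step into additions.\<close>
    have "additive_prk_step (f_part f \<phi>') (g_part g \<phi>') h a' a \<alpha>' \<alpha> \<beta>' \<beta> \<omega>' \<omega>
          z (\<lambda>i. Y i z) (\<lambda>i. P i z) (\<lambda>i. P' i z) (ynext z, pnext z)
      \<longleftrightarrow> state_step f g h a' a \<omega>' \<omega> (fst z) (\<lambda>i. Y i z) (\<lambda>i. u i z) (ynext z) \<and>
        adjoint_step f g h \<alpha>' \<alpha> \<beta>' \<beta> \<omega>' \<omega> (\<lambda>i. Y i z) (\<lambda>i. u i z) (snd z)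
          (\<lambda>i. P' i z) (\<lambda>i. P i z) (pnext z)"
      by (simp add: additive_prk_step_def state_step_def adjoint_step_def f_part_def g_part_def
          u[OF z] prod_eq_iff fst_sum snd_sum sum_negf conj_ac)
    then show "additive_prk_step (f_part f \<phi>') (g_part g \<phi>') h a' a \<alpha>' \<alpha> \<beta>' \<beta> \<omega>' \<omega>
                z (\<lambda>i. Y i z) (\<lambda>i. P i z) (\<lambda>i. P' i z) (ynext z, pnext z)"
      using state[OF z] adj[OF z] by blast
  qed
  show "\<forall>z\<in>D. sum_wedge ynext pnext z = sum_wedge fst snd z"
  proof
    fix z assume z: "z \<in> D"
    have diff: "F differentiable at z"
      if "Ck 1 F D" for F :: "(real^'k) \<times> (real^'k) \<Rightarrow> 'v::real_normed_vector"
      using that z by simp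
    show "sum_wedge ynext pnext z = sum_wedge fst snd z"
      using symplectic_step[OF assms(1,2,4,5) assms(14) z diff[OF assms(15)] diff[OF assms(16)]
          diff[OF assms(17)] diff[OF assms(18)] diff[OF assms(19)] diff[OF assms(20)]
          state adj[unfolded assms(6-9)] assms(24)]
      by simp
  qed
qed

end
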